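(* A finite graph is the intersection graph of a touching grounded configuration of L-shapes if and only if it is a forest.
   Context: Fix a horizontal line, the grounding line. An L-shape is the union of a vertical segment whose lower endpoint lies on the grounding line and a horizontal segment starting at the upper endpoint of the vertical segment and extending to the right. A configuration of shapes is grounded if all shapes lie in the closed half-plane above the grounding line, each touches the grounding line in at least one point, and no two shapes touch the grounding line at the same point. It is touching grounded if moreover any two shapes meet only on their boundaries; for curve-like shapes (such as L-shapes) this means two shapes may only touch, not cross: the drawing could be kept, up to infinitesimal changes, if every curve were replaced by a thin region with non-empty interior, with these regions meeting only on their boundaries. The intersection graph of a configuration has one vertex per shape, two vertices being adjacent iff the corresponding shapes intersect. *)

theory Defs
  imports "HOL-Analysis.Analysis"
begin

section \<open>Finite simple graphs and forests\<close>

definition simple_graph :: "'v set \<Rightarrow> 'v set set \<Rightarrow> bool" where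
  "simple_graph V E \<longleftrightarrow> finite V \<and> (\<forall>e\<in>E. e \<subseteq> V \<and> card e = 2)"

definition graph_cycle :: "'v set set \<Rightarrow> 'v list \<Rightarrow> bool" where
  "graph_cycle E vs \<longleftrightarrow> length vs \<ge> 3 \<and> distinct vs \<and>
     (\<forall>i<length vs. {vs ! i, vs ! (Suc i mod length vs)} \<in> E)"

definition forest :: "'v set set \<Rightarrow> bool" where
  "forest E \<longleftrightarrow> (\<nexists>vs. graph_cycle E vs)"


section \<open>Configurations of shapes in the plane\<close>

text \<open>A configuration is a family of shapes indexed by the vertex set \<open>V\<close>, and its
  intersection graph has vertex set \<open>V\<close>. A graph with vertex set \<open>V\<close> is thus
  (isomorphic to) the intersection graph of some configuration iff its shapes can be indexed
  by \<open>V\<close> so that the edge sets are equal.\<close>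

definition intersection_edges :: "'v set \<Rightarrow> ('v \<Rightarrow> 'a set) \<Rightarrow> 'v set set" where
  "intersection_edges V S = {{u, v} | u v. u \<in> V \<and> v \<in> V \<and> u \<noteq> v \<and> S u \<inter> S v \<noteq> {}}"

definition grounding_line :: "real \<Rightarrow> (real \<times> real) set" where
  "grounding_line h = {p. snd p = h}"

definition grounded :: "real \<Rightarrow> 'v set \<Rightarrow> ('v \<Rightarrow> (real \<times> real) set) \<Rightarrow> bool" where
  "grounded h V S \<longleftrightarrow>
     (\<forall>v\<in>V. S v \<subseteq> {p. h \<le> snd p} \<and> S v \<inter> grounding_line h \<noteq> {}) \<and>
     (\<forall>u\<in>V. \<forall>v\<in>V. u \<noteq> v \<longrightarrow> S u \<inter> S v \<inter> grounding_line h = {})"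

definition meet_only_on_boundaries ::
    "'v set \<Rightarrow> ('v \<Rightarrow> (real \<times> real) set) \<Rightarrow> bool" where
  "meet_only_on_boundaries V S \<longleftrightarrow>
     (\<forall>u\<in>V. \<forall>v\<in>V. u \<noteq> v \<longrightarrow> S u \<inter> S v \<subseteq> frontier (S u) \<inter> frontier (S v))"

text \<open>The topological boundary of a curve in the plane is the whole curve, so
  \<^const>\<open>meet_only_on_boundaries\<close> says nothing about curves themselves; it is
  applied to thin regions replacing them. A region replacing a curve runs
  along the curve, containing it in its interior, and may deviate from this only within distance
  \<open>\<epsilon>\<close> of the two endpoints. (Near an endpoint the region may have to stop short of
  the thickened side of another curve, or at the grounding line.)\<close>

definition region :: "(real \<times> real) set \<Rightarrow> bool" where
  "region R \<longleftrightarrow> (\<exists>U. open U \<and> connected U \<and> U \<noteq> {} \<and> R = closure U)"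

definition thin_region ::
    "real \<Rightarrow> (real \<Rightarrow> real \<times> real) \<Rightarrow> (real \<times> real) set \<Rightarrow> bool" where
  "thin_region \<epsilon> g R \<longleftrightarrow> region R \<and>
     R \<subseteq> (\<Union>p\<in>path_image g. ball p \<epsilon>) \<and>
     path_image g - (ball (pathstart g) \<epsilon> \<union> ball (pathfinish g) \<epsilon>) \<subseteq> interior R"

text \<open>Touching grounded configurations of curves: for arbitrarily small \<open>\<epsilon>\<close>, the curves
  can be replaced by thin regions that are still grounded, still have the same pairwise contacts,
  and meet only on their boundaries. This rules out crossings, and also two curves sharing a
  segment; one curve may end on another.\<close>

definition touching_grounded ::
    "real \<Rightarrow> 'v set \<Rightarrow> ('v \<Rightarrow> real \<Rightarrow> real \<times> real) \<Rightarrow> bool" where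
  "touching_grounded h V \<gamma> \<longleftrightarrow>
     grounded h V (\<lambda>v. path_image (\<gamma> v)) \<and>
     (\<forall>\<epsilon>>0. \<exists>R. (\<forall>v\<in>V. thin_region \<epsilon> (\<gamma> v) (R v)) \<and>
        grounded h V R \<and> meet_only_on_boundaries V R \<and>
        intersection_edges V R = intersection_edges V (\<lambda>v. path_image (\<gamma> v)))"


section \<open>L-shapes\<close>

definition L_shape :: "real \<Rightarrow> (real \<Rightarrow> real \<times> real) \<Rightarrow> bool" where
  "L_shape h g \<longleftrightarrow> (\<exists>x y z. h < y \<and> x < z \<and>
     g = linepath (x, h) (x, y) +++ linepath (x, y) (z, y))"

end

theory Submission
  imports Defs
begin

text \<open>If two L-shapes touch without crossing, the tip of the left one lies on the vertical segment of
  the right one. Hence every shape has at most one neighbour to its right, whereas the leftmost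
  shape of a cycle would have two. Conversely, a forest is drawn by inserting leaves one at a time:
  the new shape is placed immediately to the left of its neighbour and is lower than all others,
  so that it reaches that neighbour and is passed over by everything else.\<close>

section \<open>Leaves of forests\<close>

lemma forest_subset: "forest E \<Longrightarrow> E' \<subseteq> E \<Longrightarrow> forest E'"
  unfolding forest_def graph_cycle_def by blast

lemma simple_graph_edgeE:
  assumes "simple_graph V E" "e \<in> E" "v \<in> e"
  obtains u where "u \<in> V" "u \<noteq> v" "e = {v, u}"
proof -
  have e: "e \<subseteq> V" "card e = 2" using assms unfolding simple_graph_def by auto
  then obtain a b where "e = {a, b}" "a \<noteq> b" by (auto simp: card_2_iff)
  then have "v = a \<or> v = b" "a \<in> V" "b \<in> V" using e(1) assms(3) by auto
  then show thesis using that[of a] that[of b] \<open>e = {a, b}\<close> \<open>a \<noteq> b\<close>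
    by (auto simp: insert_commute)
qed

text \<open>Otherwise the first vertex of a longest path has a neighbour other than the second
  vertex; by maximality it lies on the path, and so a cycle closes. An isolated vertex satisfies the
  conclusion too, with \<open>w\<close> arbitrary.\<close>

lemma forest_has_leaf:
  assumes G: "simple_graph V E" and F: "forest E" and "V \<noteq> {}"
  shows "\<exists>v\<in>V. \<exists>w. \<forall>e\<in>E. v \<in> e \<longrightarrow> e = {v, w}"
proof (rule ccontr)
  assume "\<not> ?thesis"
  then have ex: "\<exists>e\<in>E. v \<in> e \<and> e \<noteq> {v, w}" if "v \<in> V" for v w using that by blast
  have nb: "\<exists>u\<in>V. u \<noteq> v \<and> u \<noteq> w \<and> {v, u} \<in> E" if "v \<in> V" for v w
    using ex[OF that, of w] by (metis simple_graph_edgeE[OF G])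
  define P where "P vs \<longleftrightarrow> vs \<noteq> [] \<and> distinct vs \<and> set vs \<subseteq> V \<and>
    (\<forall>i. Suc i < length vs \<longrightarrow> {vs ! i, vs ! Suc i} \<in> E)" for vs
  obtain v0 where "v0 \<in> V" using \<open>V \<noteq> {}\<close> by blast
  then have "P [v0]" by (simp add: P_def)
  moreover have "\<forall>vs. P vs \<longrightarrow> length vs < Suc (card V)"
    using G unfolding P_def simple_graph_def
    by (metis card_mono distinct_card less_Suc_eq_le)
  ultimately obtain vs where vs: "P vs" and mx: "\<forall>ws. P ws \<longrightarrow> length ws \<le> length vs"
    using ex_has_greatest_nat[of P "[v0]" length "Suc (card V)"] by blast
  have ne: "vs \<noteq> []" and d: "distinct vs" and sub: "set vs \<subseteq> V"
    and ed: "\<And>i. Suc i < length vs \<Longrightarrow> {vs ! i, vs ! Suc i} \<in> E"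
    using vs unfolding P_def by auto
  have "vs ! 0 \<in> V" using ne sub by (metis length_greater_0_conv nth_mem subsetD)
  \<comment> \<open>If the path is a single vertex, \<open>vs ! 1\<close> is an unspecified value.
    This is harmless: \<open>u \<noteq> vs ! 0\<close> alone then puts \<open>u\<close> off the
    path.\<close>
  then obtain u where u: "u \<in> V" "u \<noteq> vs ! 0" "u \<noteq> vs ! 1" "{vs ! 0, u} \<in> E"
    using nb by blast
  show False
  proof (cases "u \<in> set vs")
    case False
    have "P (u # vs)"
      unfolding P_def using False d sub u(1) u(4) ed
      by (auto simp: nth_Cons insert_commute split: nat.split)
    with mx show False by fastforce
  next
    case True
    then obtain i where i: "i < length vs" "u = vs ! i" by (metis in_set_conv_nth)
    have "i \<noteq> 0" "i \<noteq> 1" using i(2) u(2,3) by (metis, metis)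
    then have i2: "i \<ge> 2" by simp
    \<comment> \<open>The path up to \<open>u\<close>, closed by the edge from \<open>u\<close> back
      to \<open>vs ! 0\<close>; the index wraps around exactly at \<open>k = i\<close>.\<close>
    have "graph_cycle E (take (Suc i) vs)"
      unfolding graph_cycle_def
    proof (intro conjI allI impI)
      show "3 \<le> length (take (Suc i) vs)" using i i2 by simp
      show "distinct (take (Suc i) vs)" using d by simp
      fix k assume "k < length (take (Suc i) vs)"
      then have k: "k \<le> i" using i by simp
      have len: "length (take (Suc i) vs) = Suc i" using i by simp
      show "{take (Suc i) vs ! k, take (Suc i) vs ! (Suc k mod length (take (Suc i) vs))} \<in> E"
      proof (cases "k = i")
        case True
        then show ?thesis using u(4) i len by (simp add: insert_commute)
      next
        case False
        then show ?thesis using k len ed[of k] i by simp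
      qed
    qed
    with F show False unfolding forest_def by blast
  qed
qed

section \<open>Coordinates of touching configurations\<close>

text \<open>The corner of shape \<open>v\<close> is \<open>(x v, y v)\<close> and its tip is
  \<open>(z v, y v)\<close>. The strict inequalities leave room for thickening: a tip touches its
  neighbour strictly below the corner, and every other shape on the right is either not reached or
  passed over with a gap.\<close>

definition L_layout ::
    "real \<Rightarrow> 'v set \<Rightarrow> 'v set set \<Rightarrow> ('v \<Rightarrow> real) \<Rightarrow> ('v \<Rightarrow> real) \<Rightarrow> ('v \<Rightarrow> real) \<Rightarrow> bool" where
  "L_layout h V E x y z \<longleftrightarrow> inj_on x V \<and> (\<forall>v\<in>V. h < y v \<and> x v < z v) \<and>
     (\<forall>u\<in>V. \<forall>v\<in>V. x u < x v \<longrightarrow>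
        (if {u, v} \<in> E then z u = x v \<and> y u < y v else z u < x v \<or> y v < y u))"

lemma ex_less_finite:
  fixes S :: "real set"
  assumes "finite S" and "\<And>s. s \<in> S \<Longrightarrow> a < s"
  shows "\<exists>t. a < t \<and> (\<forall>s\<in>S. t < s)"
proof (cases "S = {}")
  case False
  then have "a < Min S" using assms by simp
  then obtain t where "a < t" "t < Min S" using dense by blast
  then show ?thesis using assms(1) False by auto
qed (auto intro: gt_ex)

lemma ex_greater_finite:
  fixes S :: "real set"
  assumes "finite S" and "\<And>s. s \<in> S \<Longrightarrow> s < a"
  shows "\<exists>t. t < a \<and> (\<forall>s\<in>S. s < t)"
proof -
  have "\<exists>t. - a < t \<and> (\<forall>s\<in>uminus ` S. t < s)"
    by (rule ex_less_finite) (use assms in auto)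
  then obtain t where "- a < t" "\<forall>s\<in>uminus ` S. t < s" by blast
  then show ?thesis by (intro exI[of _ "- t"]) force
qed

text \<open>Induction on the number of vertices: a leaf or isolated vertex \<open>v\<close> is
  removed, and the coordinates of the others are kept when it is put back.\<close>

lemma forest_has_L_layout:
  fixes h :: real
  assumes "simple_graph V E" "forest E"
  shows "\<exists>x y z. L_layout h V E x y z"
  using assms
proof (induction "card V" arbitrary: V E)
  case 0
  then have "V = {}" by (simp add: simple_graph_def)
  then show ?case by (simp add: L_layout_def)
next
  case (Suc n)
  have fin: "finite V" using Suc.prems by (simp add: simple_graph_def)
  have "V \<noteq> {}" using Suc.hyps(2) by auto
  then obtain v w where v: "v \<in> V" and leaf: "\<And>e. e \<in> E \<Longrightarrow> v \<in> e \<Longrightarrow> e = {v, w}"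
    using forest_has_leaf[OF Suc.prems] by blast
  define V' where "V' = V - {v}"
  define E' where "E' = {e \<in> E. v \<notin> e}"
  have "n = card V'" using Suc.hyps(2) v by (simp add: V'_def)
  moreover have "simple_graph V' E'"
    using Suc.prems(1) unfolding simple_graph_def V'_def E'_def by auto
  moreover have "forest E'" by (rule forest_subset[OF Suc.prems(2)]) (auto simp: E'_def)
  ultimately obtain x y z where L: "L_layout h V' E' x y z" using Suc.hyps(1) by blast
  have finV': "finite V'" using fin by (simp add: V'_def)
  have inj: "inj_on x V'" and yh: "\<And>u. u \<in> V' \<Longrightarrow> h < y u" and xz: "\<And>u. u \<in> V' \<Longrightarrow> x u < z u"
    using L unfolding L_layout_def by auto
  \<comment> \<open>\<open>E\<close> and \<open>E'\<close> have the same edges inside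
    \<open>V'\<close>, so the layout of the smaller forest may be read with
    \<open>E\<close>.\<close>
  have old: "if {a, b} \<in> E then z a = x b \<and> y a < y b else z a < x b \<or> y b < y a"
    if "a \<in> V'" "b \<in> V'" "x a < x b" for a b
  proof -
    have "{a, b} \<in> E' \<longleftrightarrow> {a, b} \<in> E" using that by (auto simp: E'_def V'_def)
    then show ?thesis using L that unfolding L_layout_def by metis
  qed
  have VV: "u = v \<or> u \<in> V'" if "u \<in> V" for u using that by (simp add: V'_def)
  have vV': "v \<notin> V'" by (simp add: V'_def)
  show ?case
  proof (cases "{v, w} \<in> E")
    case True
    obtain w' where "w' \<in> V" "w' \<noteq> v" "{v, w} = {v, w'}"
      using simple_graph_edgeE[OF Suc.prems(1) True] by blast
    then have wV: "w \<in> V'" by (auto simp: V'_def doubleton_eq_iff)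
    \<comment> \<open>No old vertical segment lies between \<open>xv\<close> and \<open>x w\<close>,
      so the first one to the right of the new shape is that of \<open>w\<close>.\<close>
    have "\<exists>t. t < x w \<and> (\<forall>s\<in>x ` {u \<in> V'. x u < x w}. s < t)"
      by (rule ex_greater_finite) (use finV' in auto)
    then obtain xv where xv: "xv < x w" "\<And>u. u \<in> V' \<Longrightarrow> x u < x w \<Longrightarrow> x u < xv"
      by blast
    \<comment> \<open>Being lowest, the new shape ends below the corner of \<open>w\<close> and is
      passed over by every shape coming from the left.\<close>
    have "\<exists>t. h < t \<and> (\<forall>s\<in>y ` V'. t < s)"
      by (rule ex_less_finite) (use finV' yh in auto)
    then obtain yv where yv: "h < yv" "\<And>u. u \<in> V' \<Longrightarrow> yv < y u" by blast
    have xne: "x u \<noteq> xv" if "u \<in> V'" for u using xv that by force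
    have nonadj: "{v, u} \<notin> E" "{u, v} \<notin> E" if "u \<in> V'" "u \<noteq> w" for u
      using leaf[of "{v, u}"] leaf[of "{u, v}"] that vV' by (auto simp: doubleton_eq_iff)
    have right: "u = w \<or> x w < x u" if "u \<in> V'" "xv < x u" for u
      using xv(2)[of u] that inj wV by (metis inj_onD linorder_neqE_linordered_idom not_less_iff_gr_or_eq)
    have "L_layout h V E (x(v := xv)) (y(v := yv)) (z(v := x w))"
      unfolding L_layout_def
    proof (intro conjI ballI impI)
      show "inj_on (x(v := xv)) V"
        using inj xne vV' VV unfolding inj_on_def by (metis fun_upd_apply)
    next
      fix a assume "a \<in> V"
      then show "h < (y(v := yv)) a" "(x(v := xv)) a < (z(v := x w)) a"
        using VV yh xz yv xv by (auto simp: fun_upd_apply)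
    next
      fix a b assume ab: "a \<in> V" "b \<in> V" and lt: "(x(v := xv)) a < (x(v := xv)) b"
      \<comment> \<open>In order: the contact with \<open>w\<close>; shapes beyond \<open>w\<close>,
        before which \<open>v\<close> ends; shapes left of \<open>v\<close>, which are higher; two
        old shapes.\<close>
      consider "a = v" "b = w" | "a = v" "b \<in> V'" "x w < x b" | "b = v" "a \<in> V'" "a \<noteq> w"
        | "a \<in> V'" "b \<in> V'"
        using VV[OF ab(1)] VV[OF ab(2)] lt right xv(1) vV'
        by (metis fun_upd_apply less_irrefl not_less_iff_gr_or_eq)
      then show "if {a, b} \<in> E then (z(v := x w)) a = (x(v := xv)) b \<and> (y(v := yv)) a < (y(v := yv)) b
                 else (z(v := x w)) a < (x(v := xv)) b \<or> (y(v := yv)) b < (y(v := yv)) a"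
      proof cases
        case 1
        then show ?thesis using True vV' wV yv by auto
      next
        case 2
        then have "b \<noteq> w" by auto
        then show ?thesis using 2 nonadj[of b] vV' by auto
      next
        case 3
        then show ?thesis using nonadj[of a] vV' yv by auto
      next
        case 4
        then have "a \<noteq> v" "b \<noteq> v" using vV' by auto
        then show ?thesis using old[OF 4] lt by simp
      qed
    qed
    then show ?thesis by blast
  next
    case False
    then have iso: "{v, u} \<notin> E" "{u, v} \<notin> E" for u
      using leaf[of "{v, u}"] leaf[of "{u, v}"] by auto
    \<comment> \<open>Here \<open>v\<close> is isolated. It is placed to the right of all tips,
      where nothing reaches it; its height and length are then arbitrary.\<close>
    obtain c where c: "\<And>u. u \<in> V' \<Longrightarrow> z u < c"
    proof -
      have "bdd_above (z ` V')" using finV' by (simp add: bdd_above_finite)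
      then obtain c where c: "\<And>u. u \<in> V' \<Longrightarrow> z u \<le> c" by (auto simp: bdd_above_def)
      show thesis by (rule that[of "c + 1"]) (use c in force)
    qed
    have xc: "x u < c" if "u \<in> V'" for u using c[OF that] xz[OF that] by simp
    have "L_layout h V E (x(v := c)) (y(v := h + 1)) (z(v := c + 1))"
      unfolding L_layout_def
    proof (intro conjI ballI impI)
      show "inj_on (x(v := c)) V"
        using inj xc vV' VV unfolding inj_on_def by (metis fun_upd_apply less_irrefl)
    next
      fix a assume "a \<in> V"
      then show "h < (y(v := h + 1)) a" "(x(v := c)) a < (z(v := c + 1)) a"
        using VV yh xz by (auto simp: fun_upd_apply)
    next
      fix a b assume ab: "a \<in> V" "b \<in> V" and lt: "(x(v := c)) a < (x(v := c)) b"
      have aV: "a \<noteq> v" using lt xc[of b] VV[OF ab(2)] by (auto split: if_splits)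
      then have aV': "a \<in> V'" using VV ab by blast
      show "if {a, b} \<in> E then (z(v := c + 1)) a = (x(v := c)) b \<and> (y(v := h + 1)) a < (y(v := h + 1)) b
            else (z(v := c + 1)) a < (x(v := c)) b \<or> (y(v := h + 1)) b < (y(v := h + 1)) a"
      proof (cases "b = v")
        case True
        then show ?thesis using iso[of a] aV c[OF aV'] by simp
      next
        case False
        then have "b \<in> V'" using VV ab by blast
        then show ?thesis using old[OF aV' \<open>b \<in> V'\<close>] lt aV False by simp
      qed
    qed
    then show ?thesis by blast
  qed
qed

section \<open>L-shapes\<close>

definition hook :: "real \<Rightarrow> real \<Rightarrow> real \<Rightarrow> real \<Rightarrow> real \<Rightarrow> real \<times> real" where
  "hook h x y z = linepath (x, h) (x, y) +++ linepath (x, y) (z, y)"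

lemma L_shape_hook: "h < y \<Longrightarrow> x < z \<Longrightarrow> L_shape h (hook h x y z)"
  unfolding L_shape_def hook_def by blast

lemma pathstart_hook [simp]: "pathstart (hook h x y z) = (x, h)"
  and pathfinish_hook [simp]: "pathfinish (hook h x y z) = (z, y)"
  by (simp_all add: hook_def)

lemma path_image_hook:
  assumes "h < y" "x < z"
  shows "path_image (hook h x y z) = {x} \<times> {h..y} \<union> {x..z} \<times> {y}"
proof -
  have "closed_segment (x, h) (x, y) = {x} \<times> {h..y}"
    using assms by (simp add: closed_segment_same_fst closed_segment_eq_real_ivl)
  moreover have "closed_segment (x, y) (z, y) = {x..z} \<times> {y}"
    using assms by (simp add: closed_segment_same_snd closed_segment_eq_real_ivl)
  ultimately show ?thesis by (simp add: hook_def path_image_join)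
qed

text \<open>Since the second hook starts further right, a common point lies on the horizontal
  segment of the first, hence at height \<open>y\<close>. Conversely, \<open>(x', y)\<close> is a
  common point.\<close>

lemma hooks_meet_iff:
  assumes "h < y" "x < z" "h < y'" "x' < z'" "x < x'"
  shows "path_image (hook h x y z) \<inter> path_image (hook h x' y' z') \<noteq> {} \<longleftrightarrow> x' \<le> z \<and> y \<le> y'"
proof
  assume "x' \<le> z \<and> y \<le> y'"
  then have "(x', y) \<in> path_image (hook h x y z) \<inter> path_image (hook h x' y' z')"
    using assms by (simp add: path_image_hook)
  then show "path_image (hook h x y z) \<inter> path_image (hook h x' y' z') \<noteq> {}" by blast
qed (use assms in \<open>auto simp: path_image_hook\<close>)

section \<open>From touching L-shapes to forests\<close>

text \<open>This excludes overlaps as well as crossings: if \<open>y = y'\<close> and the left hook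
  extends beyond \<open>x'\<close>, the common point \<open>(x', y)\<close> is the corner of the
  right hook, again not an endpoint.\<close>

lemma touching_hooks_tip:
  assumes tg: "touching_grounded h V \<gamma>" and uv: "u \<in> V" "v \<in> V"
    and u: "\<gamma> u = hook h x y z" "h < y" "x < z"
    and v: "\<gamma> v = hook h x' y' z'" "h < y'" "x' < z'"
    and "x < x'" and meet: "path_image (\<gamma> u) \<inter> path_image (\<gamma> v) \<noteq> {}"
  shows "z = x'"
proof (rule ccontr)
  assume "z \<noteq> x'"
  then have c: "x' < z" "y \<le> y'"
    using meet hooks_meet_iff u v \<open>x < x'\<close> by (metis order_le_less)+
  \<comment> \<open>The crossing point is an endpoint of neither curve, so thin regions contain it in their interiors.\<close>
  define p where "p = (x', y)"
  \<comment> \<open>The four endpoints; only near these may a thin region leave its curve.\<close>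
  define D where "D = {(x, h), (z, y), (x', h), (z', y')}"
  have "p \<notin> D" using c \<open>x < x'\<close> u v by (auto simp: p_def D_def)
  then have "\<exists>\<epsilon>>0. \<forall>q\<in>D. q \<noteq> p \<longrightarrow> \<epsilon> \<le> dist p q"
    by (intro finite_set_avoid) (simp add: D_def)
  then obtain \<epsilon> where eps: "\<epsilon> > 0" "\<And>q. q \<in> D \<Longrightarrow> \<epsilon> \<le> dist p q"
    using \<open>p \<notin> D\<close> by metis
  obtain R where R: "\<And>v. v \<in> V \<Longrightarrow> thin_region \<epsilon> (\<gamma> v) (R v)" and mb: "meet_only_on_boundaries V R"
    using tg eps(1) unfolding touching_grounded_def by metis
  have out: "p \<notin> ball q \<epsilon>" if "q \<in> D" for q using eps(2)[OF that] by (simp add: dist_commute)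
  have "p \<in> path_image (\<gamma> u)" "p \<in> path_image (\<gamma> v)"
    using c u v \<open>x < x'\<close> by (simp_all add: path_image_hook p_def)
  then have "p \<in> interior (R u)" "p \<in> interior (R v)"
    using R[OF uv(1)] R[OF uv(2)] out u(1) v(1) unfolding thin_region_def D_def by auto
  moreover have "u \<noteq> v" using u v \<open>x < x'\<close>
    by (metis pathstart_hook fst_conv less_irrefl)
  ultimately have "p \<in> frontier (R u)"
    using mb uv interior_subset unfolding meet_only_on_boundaries_def by blast
  with \<open>p \<in> interior (R u)\<close> show False by (simp add: frontier_def)
qed

lemma touching_L_shapes_forest:
  fixes \<gamma> :: "'v \<Rightarrow> real \<Rightarrow> real \<times> real"
  assumes L: "\<forall>v\<in>V. L_shape h (\<gamma> v)" and tg: "touching_grounded h V \<gamma>"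
  shows "forest (intersection_edges V (\<lambda>v. path_image (\<gamma> v)))"
proof -
  define E where "E = intersection_edges V (\<lambda>v. path_image (\<gamma> v))"
  have "\<forall>v\<in>V. \<exists>x y z. h < y \<and> x < z \<and> \<gamma> v = hook h x y z"
    using L unfolding L_shape_def hook_def by blast
  then obtain x y z where H: "\<And>v. v \<in> V \<Longrightarrow> h < y v \<and> x v < z v \<and> \<gamma> v = hook h (x v) (y v) (z v)"
    by metis
  \<comment> \<open>Shapes with equal \<open>x\<close> would share the point \<open>(x u, h)\<close>
    of the grounding line.\<close>
  have inj: "u = v" if "u \<in> V" "v \<in> V" "x u = x v" for u v
  proof (rule ccontr)
    assume "u \<noteq> v"
    then have "path_image (\<gamma> u) \<inter> path_image (\<gamma> v) \<inter> grounding_line h = {}"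
      using tg that unfolding touching_grounded_def grounded_def by blast
    moreover have "(x u, h) \<in> path_image (\<gamma> w)" if "w \<in> V" "x w = x u" for w
      using H[OF that(1)] that(2) by (auto simp: path_image_hook)
    moreover have "(x u, h) \<in> grounding_line h" by (simp add: grounding_line_def)
    ultimately show False using that by (metis IntI empty_iff)
  qed
  have E: "u \<in> V" "v \<in> V" "u \<noteq> v" "path_image (\<gamma> u) \<inter> path_image (\<gamma> v) \<noteq> {}"
    if "{u, v} \<in> E" for u v
    using that unfolding E_def intersection_edges_def by (auto simp: doubleton_eq_iff)
  have tip: "z u = x v" if "{u, v} \<in> E" "x u \<le> x v" for u v
  proof -
    have "x u < x v" using that inj E[OF that(1)] by force
    then show ?thesis using touching_hooks_tip[OF tg] H E[OF that(1)] by blast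
  qed
  have "\<not> graph_cycle E vs" for vs
  proof
    assume c: "graph_cycle E vs"
    define n where "n = length vs"
    have n: "n \<ge> 3" "distinct vs" and ed: "\<And>i. i < n \<Longrightarrow> {vs ! i, vs ! (Suc i mod n)} \<in> E"
      using c unfolding graph_cycle_def n_def by auto
    have "\<exists>i. is_arg_min (\<lambda>i. x (vs ! i)) (\<lambda>i. i \<in> {..<n}) i"
      using n(1) by (intro ex_is_arg_min_if_finite) (auto simp: lessThan_empty_iff)
    then obtain i where i: "i < n" and mn: "\<And>j. j < n \<Longrightarrow> x (vs ! i) \<le> x (vs ! j)"
      by (auto simp: is_arg_min_linorder)
    define k where "k = Suc i mod n"
    \<comment> \<open>The cyclic predecessor of \<open>i\<close>, with wrap-around at 0. It differs
      from the successor \<open>k\<close> because the cycle has length at least 3.\<close>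
    define j where "j = (if i = 0 then n - 1 else i - 1)"
    have jk: "j < n" "k < n" "Suc j mod n = i" "j \<noteq> k"
      using i n(1) by (auto simp: j_def k_def mod_Suc)
    have e: "{vs ! i, vs ! k} \<in> E" "{vs ! i, vs ! j} \<in> E"
      using ed[OF i] ed[OF jk(1)] jk(3) by (auto simp: k_def insert_commute)
    \<comment> \<open>As \<open>vs ! i\<close> is leftmost, both of its cycle neighbours have their
      vertical segment at its tip.\<close>
    then have "x (vs ! k) = x (vs ! j)" using tip mn jk by metis
    then have "vs ! k = vs ! j" using inj E e by blast
    then show False using jk n(2) by (simp add: nth_eq_iff_index_eq n_def)
  qed
  then show ?thesis unfolding forest_def E_def by blast
qed

section \<open>Thin regions around L-shapes\<close>

text \<open>The right end is cut back by \<open>\<delta>\<close>, to the left side of the thickened vertical segment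
  on which the tip lies.\<close>

definition thick_hook :: "real \<Rightarrow> real \<Rightarrow> real \<Rightarrow> real \<Rightarrow> real \<Rightarrow> (real \<times> real) set" where
  "thick_hook \<delta> h x y z =
     {x - \<delta>..x + \<delta>} \<times> {h..y + \<delta>} \<union> {x - \<delta>..z - \<delta>} \<times> {y - \<delta>..y + \<delta>}"

text \<open>The region is the closure of two open rectangles that overlap at the corner, and its
  points are within \<delta> of the hook in each coordinate, hence at distance at most
  \<open>2 * \<delta>\<close>.\<close>

lemma thin_region_thick_hook:
  assumes d: "0 < \<delta>" "2 * \<delta> < \<epsilon>" "2 * \<delta> < z - x" "2 * \<delta> < y - h"
  shows "thin_region \<epsilon> (hook h x y z) (thick_hook \<delta> h x y z)"
proof -
  define A where "A = {x - \<delta><..<x + \<delta>} \<times> {h<..<y + \<delta>}"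
  define B where "B = {x - \<delta><..<z - \<delta>} \<times> {y - \<delta><..<y + \<delta>}"
  have op: "open (A \<union> B)" by (auto simp: A_def B_def intro!: open_Times)
  have ne: "(x, y) \<in> A" "(x, y) \<in> B" using d by (auto simp: A_def B_def)
  have "connected (A \<union> B)"
  proof (rule connected_Un)
    show "connected A" "connected B"
      unfolding A_def B_def by (intro convex_connected convex_Times convex_real_interval)+
    show "A \<inter> B \<noteq> {}" using ne by blast
  qed
  moreover have cl: "thick_hook \<delta> h x y z = closure (A \<union> B)"
    using d by (simp add: A_def B_def closure_Times thick_hook_def)
  ultimately have "region (thick_hook \<delta> h x y z)" unfolding region_def using op ne by blast
  moreover have "thick_hook \<delta> h x y z \<subseteq> (\<Union>p\<in>path_image (hook h x y z). ball p \<epsilon>)"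
  proof
    fix p assume p: "p \<in> thick_hook \<delta> h x y z"
    obtain s t where st: "p = (s, t)" by (cases p)
    \<comment> \<open>A nearby point of the hook: project onto the vertical segment, capping the
      height at the corner, or onto the horizontal one.\<close>
    define q where "q = (if s \<le> x + \<delta> then (x, min t y) else (s, y))"
    have q: "q \<in> path_image (hook h x y z)"
      using p d by (auto simp: thick_hook_def path_image_hook st q_def)
    have "\<bar>fst q - s\<bar> \<le> \<delta>" "\<bar>snd q - t\<bar> \<le> \<delta>"
      using p d by (auto simp: thick_hook_def st q_def)
    moreover have "dist q p \<le> \<bar>fst q - s\<bar> + \<bar>snd q - t\<bar>"
      by (simp add: dist_prod_def st dist_real_def sqrt_sum_squares_le_sum_abs)
    ultimately have "dist q p < \<epsilon>" using d by linarith
    then show "p \<in> (\<Union>p\<in>path_image (hook h x y z). ball p \<epsilon>)" using q by auto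
  qed
  moreover have "path_image (hook h x y z) - (ball (x, h) \<epsilon> \<union> ball (z, y) \<epsilon>) \<subseteq> interior (thick_hook \<delta> h x y z)"
  proof -
    have "path_image (hook h x y z) - (ball (x, h) \<epsilon> \<union> ball (z, y) \<epsilon>) \<subseteq> A \<union> B"
    proof
      fix p assume p: "p \<in> path_image (hook h x y z) - (ball (x, h) \<epsilon> \<union> ball (z, y) \<epsilon>)"
      obtain s t where st: "p = (s, t)" by (cases p)
      have "dist (x, h) p \<ge> \<epsilon>" "dist (z, y) p \<ge> \<epsilon>" using p by auto
      \<comment> \<open>So the remaining points have height at least \<open>h + \<epsilon>\<close>
        on the vertical segment, or abscissa at most \<open>z - \<epsilon> < z - \<delta>\<close> on
        the horizontal one, which puts them into \<open>A \<union> B\<close>.\<close>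
      then have "s = x \<Longrightarrow> \<bar>h - t\<bar> \<ge> \<epsilon>" "t = y \<Longrightarrow> \<bar>z - s\<bar> \<ge> \<epsilon>"
        by (auto simp: st dist_prod_def dist_real_def)
      then show "p \<in> A \<union> B" using p d by (auto simp: st A_def B_def path_image_hook)
    qed
    also have "\<dots> \<subseteq> interior (thick_hook \<delta> h x y z)"
      unfolding cl using op closure_subset by (rule interior_maximal[rotated])
    finally show ?thesis .
  qed
  ultimately show ?thesis by (simp add: thin_region_def)
qed

text \<open>The interiors lie strictly on either side of the line at abscissa \<open>c\<close>, so
  neither meets the other set.\<close>

lemma Int_subset_frontier_of_half_planes:
  fixes A B :: "(real \<times> real) set"
  assumes "A \<subseteq> {..c} \<times> UNIV" "B \<subseteq> {c..} \<times> UNIV"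
  shows "A \<inter> B \<subseteq> frontier A \<inter> frontier B"
proof -
  have "interior A \<subseteq> {..<c} \<times> UNIV" "interior B \<subseteq> {c<..} \<times> UNIV"
    using interior_mono[OF assms(1)] interior_mono[OF assms(2)] by (simp_all add: interior_Times)
  then have "interior A \<inter> B = {}" "A \<inter> interior B = {}" using assms by fastforce+
  then show ?thesis using closure_subset unfolding frontier_def by blast
qed

section \<open>From coordinates to touching configurations\<close>

lemma L_layout_touching:
  assumes EV: "simple_graph V E" and L: "L_layout h V E x y z"
  defines "\<gamma> \<equiv> \<lambda>v. hook h (x v) (y v) (z v)"
  shows "touching_grounded h V \<gamma> \<and> E = intersection_edges V (\<lambda>v. path_image (\<gamma> v))"
proof -
  have "finite V" using EV by (simp add: simple_graph_def)
  have inj: "inj_on x V" and H: "\<And>v. v \<in> V \<Longrightarrow> h < y v" "\<And>v. v \<in> V \<Longrightarrow> x v < z v"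
    using L unfolding L_layout_def by auto
  have adj: "z u = x v \<and> y u < y v" if "u \<in> V" "v \<in> V" "x u < x v" "{u, v} \<in> E" for u v
    using L that unfolding L_layout_def by metis
  have nonadj: "z u < x v \<or> y v < y u" if "u \<in> V" "v \<in> V" "x u < x v" "{u, v} \<notin> E" for u v
    using L that unfolding L_layout_def by metis
  \<comment> \<open>Stated for arbitrary shapes because it serves both the curves and the regions;
    by symmetry, pairs ordered by \<open>x\<close> suffice.\<close>
  have edges: "intersection_edges V S = E"
    if S: "\<And>u v. u \<in> V \<Longrightarrow> v \<in> V \<Longrightarrow> x u < x v \<Longrightarrow> S u \<inter> S v \<noteq> {} \<longleftrightarrow> {u, v} \<in> E"
    for S :: "'a \<Rightarrow> (real \<times> real) set"
  proof -
    have *: "S u \<inter> S v \<noteq> {} \<longleftrightarrow> {u, v} \<in> E" if "u \<in> V" "v \<in> V" "u \<noteq> v" for u v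
      using S[of u v] S[of v u] that inj_onD[OF inj, of u v]
      by (metis Int_commute insert_commute linorder_neqE_linordered_idom)
    have "\<exists>u v. e = {u, v} \<and> u \<in> V \<and> v \<in> V \<and> u \<noteq> v" if "e \<in> E" for e
      using EV that unfolding simple_graph_def by (metis card_2_iff insert_subset)
    with * show ?thesis unfolding intersection_edges_def by (auto; metis)
  qed
  have E: "intersection_edges V (\<lambda>v. path_image (\<gamma> v)) = E"
  proof (rule edges)
    fix u v assume uv: "u \<in> V" "v \<in> V" "x u < x v"
    show "path_image (\<gamma> u) \<inter> path_image (\<gamma> v) \<noteq> {} \<longleftrightarrow> {u, v} \<in> E"
      using uv H hooks_meet_iff[of h "y u" "x u" "z u" "y v" "x v" "z v"] adj[OF uv] nonadj[OF uv]
      by (fastforce simp: \<gamma>_def)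
  qed
  have gr: "grounded h V (\<lambda>v. path_image (\<gamma> v))"
    unfolding grounded_def
  proof (intro conjI ballI impI)
    fix v assume v: "v \<in> V"
    then show "path_image (\<gamma> v) \<subseteq> {p. h \<le> snd p}"
      using H[OF v] by (auto simp: \<gamma>_def path_image_hook)
    have "(x v, h) \<in> path_image (\<gamma> v) \<inter> grounding_line h"
      using H[OF v] by (auto simp: \<gamma>_def path_image_hook grounding_line_def)
    then show "path_image (\<gamma> v) \<inter> grounding_line h \<noteq> {}" by blast
  next
    fix u v assume uv: "u \<in> V" "v \<in> V" "u \<noteq> v"
    then have "x u \<noteq> x v" using inj by (auto dest: inj_onD)
    then show "path_image (\<gamma> u) \<inter> path_image (\<gamma> v) \<inter> grounding_line h = {}"
      using H[OF uv(1)] H[OF uv(2)] by (auto simp: \<gamma>_def path_image_hook grounding_line_def)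
  qed
  have "\<exists>R. (\<forall>v\<in>V. thin_region \<epsilon> (\<gamma> v) (R v)) \<and> grounded h V R \<and> meet_only_on_boundaries V R \<and>
          intersection_edges V R = E" if eps: "\<epsilon> > 0" for \<epsilon>
  proof -
    \<comment> \<open>Finitely many positive gaps have to exceed \<open>2 * \<delta>\<close>, the
      factor 2 because both shapes are thickened; all sufficiently small \<delta> satisfy
      this.\<close>
    have small: "\<forall>\<^sub>F d in at_right 0. 2 * d < c" if "0 < c" for c :: real
      unfolding eventually_at_right_field using that by (intro exI[of _ "c / 2"]) auto
    have "\<forall>\<^sub>F d in at_right 0. 0 < d \<and> 2 * d < \<epsilon> \<and>
        (\<forall>v\<in>V. 2 * d < z v - x v) \<and> (\<forall>v\<in>V. 2 * d < y v - h) \<and>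
        (\<forall>u\<in>V. \<forall>v\<in>{v \<in> V. x u < x v}. 2 * d < x v - x u) \<and>
        (\<forall>u\<in>V. \<forall>v\<in>{v \<in> V. y u < y v}. 2 * d < y v - y u)"
      by (intro eventually_conj eventually_ball_finite ballI small eventually_at_right_less)
        (use \<open>finite V\<close> H eps in auto)
    from eventually_happens'[OF trivial_limit_at_right_real this]
    obtain \<delta> where d: "0 < \<delta>" "2 * \<delta> < \<epsilon>"
      and dz: "\<And>v. v \<in> V \<Longrightarrow> 2 * \<delta> < z v - x v" and dy: "\<And>v. v \<in> V \<Longrightarrow> 2 * \<delta> < y v - h"
      and dxx: "\<And>u v. u \<in> V \<Longrightarrow> v \<in> V \<Longrightarrow> x u < x v \<Longrightarrow> 2 * \<delta> < x v - x u"
      and dyy: "\<And>u v. u \<in> V \<Longrightarrow> v \<in> V \<Longrightarrow> y u < y v \<Longrightarrow> 2 * \<delta> < y v - y u"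
      by auto
    define R where "R v = thick_hook \<delta> h (x v) (y v) (z v)" for v
    have thin: "thin_region \<epsilon> (\<gamma> v) (R v)" if "v \<in> V" for v
      unfolding R_def \<gamma>_def using that d dz dy by (intro thin_region_thick_hook) auto
    \<comment> \<open>If \<open>z u < x v\<close>, the region of \<open>u\<close> ends at
      \<open>z u - \<delta>\<close>, before that of \<open>v\<close> begins at
      \<open>x v - \<delta>\<close>. Otherwise the horizontal part of \<open>u\<close> stays above
      height \<open>y v + \<delta>\<close>.\<close>
    have sep: "R u \<inter> R v = {}" if uv: "u \<in> V" "v \<in> V" "x u < x v" "{u, v} \<notin> E" for u v
      using nonadj[OF uv]
    proof
      assume "z u < x v"
      then show ?thesis using dxx[OF uv(1-3)] dz[OF uv(1)] dz[OF uv(2)] d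
        by (auto simp: R_def thick_hook_def)
    next
      assume "y v < y u"
      then show ?thesis using dxx[OF uv(1-3)] dz[OF uv(1)] dz[OF uv(2)] dy[OF uv(2)]
          dyy[OF uv(2) uv(1)] d
        by (auto simp: R_def thick_hook_def)
    qed
    have touch: "R u \<inter> R v \<noteq> {}" "R u \<inter> R v \<subseteq> frontier (R u) \<inter> frontier (R v)"
      if uv: "u \<in> V" "v \<in> V" "x u < x v" "{u, v} \<in> E" for u v
    proof -
      have zx: "z u = x v" "y u < y v" using adj[OF uv] by auto
      \<comment> \<open>The cut-back end of \<open>u\<close> meets the left side of the thickened
        vertical segment of \<open>v\<close>; the line at abscissa \<open>x v - \<delta>\<close>
        separates the interiors.\<close>
      have "(x v - \<delta>, y u) \<in> R u \<inter> R v"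
        using zx dz[OF uv(1)] H[OF uv(1)] d by (auto simp: R_def thick_hook_def)
      then show "R u \<inter> R v \<noteq> {}" by blast
      have "R u \<subseteq> {..x v - \<delta>} \<times> UNIV" "R v \<subseteq> {x v - \<delta>..} \<times> UNIV"
        using zx dxx[OF uv(1-3)] dz[OF uv(1)] d by (auto simp: R_def thick_hook_def)
      then show "R u \<inter> R v \<subseteq> frontier (R u) \<inter> frontier (R v)"
        by (rule Int_subset_frontier_of_half_planes)
    qed
    have "R u \<inter> R v \<subseteq> frontier (R u) \<inter> frontier (R v)" if "u \<in> V" "v \<in> V" "x u < x v" for u v
      using sep[OF that] touch(2)[OF that] by (cases "{u, v} \<in> E") auto
    then have "R u \<inter> R v \<subseteq> frontier (R u) \<inter> frontier (R v)" if "u \<in> V" "v \<in> V" "u \<noteq> v" for u v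
      using that inj_onD[OF inj, of u v] by (cases "x u" "x v" rule: linorder_cases) blast+
    then have "meet_only_on_boundaries V R" unfolding meet_only_on_boundaries_def by blast
    moreover have "intersection_edges V R = E"
      by (rule edges) (use sep touch(1) in blast)
    moreover have "grounded h V R"
      unfolding grounded_def
    proof (intro conjI ballI impI)
      fix v assume v: "v \<in> V"
      show "R v \<subseteq> {p. h \<le> snd p}"
        using dy[OF v] d by (auto simp: R_def thick_hook_def)
      have "(x v, h) \<in> R v \<inter> grounding_line h"
        using dy[OF v] d by (auto simp: R_def thick_hook_def grounding_line_def)
      then show "R v \<inter> grounding_line h \<noteq> {}" by blast
    next
      fix u v assume uv: "u \<in> V" "v \<in> V" "u \<noteq> v"
      then have "2 * \<delta> < \<bar>x u - x v\<bar>"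
        using dxx[of u v] dxx[of v u] inj_onD[OF inj, of u v] by linarith
      \<comment> \<open>By \<open>dy\<close> the horizontal strips stay above the grounding line, so
        only the bases of the vertical strips matter.\<close>
      then show "R u \<inter> R v \<inter> grounding_line h = {}"
        using dy[OF uv(1)] dy[OF uv(2)] d by (auto simp: R_def thick_hook_def grounding_line_def)
    qed
    ultimately show ?thesis using thin by blast
  qed
  then show ?thesis using gr E unfolding touching_grounded_def by simp
qed

theorem theorem1:
  fixes V :: "'v set" and E :: "'v set set" and h :: real
  assumes "simple_graph V E"
  shows "(\<exists>\<gamma> :: 'v \<Rightarrow> real \<Rightarrow> real \<times> real.
            (\<forall>v\<in>V. L_shape h (\<gamma> v)) \<and> touching_grounded h V \<gamma> \<and>
            E = intersection_edges V (\<lambda>v. path_image (\<gamma> v)))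
         \<longleftrightarrow> forest E"
proof
  assume "forest E"
  then obtain x y z where L: "L_layout h V E x y z" using forest_has_L_layout assms by blast
  have "\<forall>v\<in>V. L_shape h (hook h (x v) (y v) (z v))"
    using L by (auto simp: L_layout_def intro: L_shape_hook)
  then show "\<exists>\<gamma> :: 'v \<Rightarrow> real \<Rightarrow> real \<times> real.
      (\<forall>v\<in>V. L_shape h (\<gamma> v)) \<and> touching_grounded h V \<gamma> \<and>
      E = intersection_edges V (\<lambda>v. path_image (\<gamma> v))"
    using L_layout_touching[OF assms L] by (intro exI conjI[rotated]) auto
qed (use touching_L_shapes_forest in blast)

end
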